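(* Suppose that $\alpha>0$ is an irrational number whose continued fraction digits are unbounded. Then there exists an infinite sequence of vertical intervals $B_\sigma$, $\sigma=1,2,3,\ldots$, in the unit torus $[0,1)^2$ with the following property. For every $\sigma$, let $\mathcal{P}_\sigma$ denote the unit torus $[0,1)^2$ modified by the addition of the vertical one-sided barrier $B_\sigma$, and let $\mathcal{R}(\mathcal{P}_\sigma;\alpha)$ be the recurrent set under dissipative flow of slope $\alpha$ on $\mathcal{P}_\sigma$. Then $$\lambda_2(\mathcal{R}(\mathcal{P}_\sigma;\alpha))\to0\quad\text{as }\sigma\to\infty .$$
   Context: $\lambda_2$ denotes $2$-dimensional Lebesgue measure. The barrier is $B_\sigma=\{x_\sigma\}\times J_\sigma$, where $0<x_\sigma<1$ and $J_\sigma\subset[0,1)$ is an interval of positive length; its counterpart on the left vertical edge of the torus is $A_\sigma=\{0\}\times J_\sigma$. Dissipative flow of slope $\alpha$ on $\mathcal{P}_\sigma$: a flow line moves from left to right at unit speed in the direction $(1,\alpha)$ as on the ordinary unit torus, except that whenever it hits a point $(x_\sigma,y)\in B_\sigma$ from the left it continues, in the same direction, from the corresponding point $(0,y)\in A_\sigma$. (A flow line that starts on $B_\sigma$ emanates from the right side of $B_\sigma$.) For $t\ge0$, $\mathbf{T}_\alpha^{(t)}$ is the operator which advances a point along its dissipative flow line by time $t$. A point $P\in\mathcal{P}_\sigma$ is wandering if there exist an open neighbourhood $D$ of $P$ and $t_0\ge0$ such that $D\cap\mathbf{T}_\alpha^{(t)}(D)=\emptyset$ for every $t>t_0$; otherwise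 it is non-wandering. The recurrent set $\mathcal{R}(\mathcal{P}_\sigma;\alpha)$ is the set of all non-wandering points of $\mathcal{P}_\sigma$. *)

theory Defs
  imports "HOL-Analysis.Analysis"
begin

text \<open>Complete quotients and digits of the simple continued fraction of an irrational number.\<close>

primrec cfrac_quotient :: "real \<Rightarrow> nat \<Rightarrow> real" where
  "cfrac_quotient a 0 = a"
| "cfrac_quotient a (Suc n) = 1 / frac (cfrac_quotient a n)"

definition cfrac_digit :: "real \<Rightarrow> nat \<Rightarrow> int" where
  "cfrac_digit a n = \<lfloor>cfrac_quotient a n\<rfloor>"


text \<open>The torus is represented by the fundamental domain \<open>[0,1)\<^sup>2\<close>; \<open>wrap\<close> is the
  covering projection from the plane, and \<open>torus_open\<close> is openness in the quotient topology.\<close>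

definition unit_torus :: "(real \<times> real) set" where
  "unit_torus = {0..<1} \<times> {0..<1}"

definition wrap :: "real \<times> real \<Rightarrow> real \<times> real" where
  "wrap p = (frac (fst p), frac (snd p))"

definition torus_open :: "(real \<times> real) set \<Rightarrow> bool" where
  "torus_open D \<longleftrightarrow> D \<subseteq> unit_torus \<and> open (wrap -` D)"

definition torus_line :: "real \<Rightarrow> real \<Rightarrow> real \<times> real \<Rightarrow> real \<times> real" where
  "torus_line \<alpha> t p = wrap (p + (t / sqrt (1 + \<alpha>\<^sup>2)) *\<^sub>R (1, \<alpha>))"

definition barrier :: "real \<Rightarrow> real set \<Rightarrow> (real \<times> real) set" where
  "barrier x J = {x} \<times> J"


text \<open>\<open>dissipates \<alpha> x J t p q\<close>: the dissipative flow line from \<open>p\<close> is at \<open>q\<close> at time \<open>t\<close>.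
  In rule \<open>hit\<close>, \<open>s\<close> is the first strictly positive time at which the line meets the barrier.
  Motion is always to the right, so it is then met from the left, whereas a line that starts on
  the barrier (time \<open>0\<close>) leaves it to the right. At the moment of a hit the flow line is
  already at the corresponding point of the left edge.\<close>

inductive dissipates ::
    "real \<Rightarrow> real \<Rightarrow> real set \<Rightarrow> real \<Rightarrow> real \<times> real \<Rightarrow> real \<times> real \<Rightarrow> bool"
  for \<alpha> x :: real and J :: "real set" where
  free: "0 \<le> t \<Longrightarrow> (\<And>s. 0 < s \<Longrightarrow> s \<le> t \<Longrightarrow> torus_line \<alpha> s p \<notin> barrier x J)
    \<Longrightarrow> dissipates \<alpha> x J t p (torus_line \<alpha> t p)"
| hit: "0 < s \<Longrightarrow> s \<le> t \<Longrightarrow> torus_line \<alpha> s p \<in> barrier x J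
    \<Longrightarrow> (\<And>r. 0 < r \<Longrightarrow> r < s \<Longrightarrow> torus_line \<alpha> r p \<notin> barrier x J)
    \<Longrightarrow> dissipates \<alpha> x J (t - s) (0, snd (torus_line \<alpha> s p)) q
    \<Longrightarrow> dissipates \<alpha> x J t p q"

definition dissipative_flow ::
    "real \<Rightarrow> real \<Rightarrow> real set \<Rightarrow> real \<Rightarrow> real \<times> real \<Rightarrow> real \<times> real" where
  "dissipative_flow \<alpha> x J t p = (THE q. dissipates \<alpha> x J t p q)"

definition wandering :: "real \<Rightarrow> real \<Rightarrow> real set \<Rightarrow> real \<times> real \<Rightarrow> bool" where
  "wandering \<alpha> x J p \<longleftrightarrow> (\<exists>D t\<^sub>0. torus_open D \<and> p \<in> D \<and> 0 \<le> t\<^sub>0 \<and>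
     (\<forall>t>t\<^sub>0. D \<inter> dissipative_flow \<alpha> x J t ` D = {}))"

definition recurrent_set :: "real \<Rightarrow> real \<Rightarrow> real set \<Rightarrow> (real \<times> real) set" where
  "recurrent_set \<alpha> x J = {p \<in> unit_torus. \<not> wandering \<alpha> x J p}"


text \<open>The flow is well defined: the description in \<open>dissipative_flow\<close> always denotes.\<close>

lemma dissipates_unique:
  assumes "dissipates \<alpha> x J t p q" "dissipates \<alpha> x J t p q'"
  shows "q = q'"
  using assms
proof (induction arbitrary: q' rule: dissipates.induct)
  case (free t p)
  from free.prems show ?case
    by (cases rule: dissipates.cases) (use free.hyps in auto)
next
  case (hit s t p q)
  from hit.prems show ?case
  proof (cases rule: dissipates.cases)
    case free
    then show ?thesis using hit.hyps by auto
  next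
    case (hit s')
    then have "s' = s"
      using \<open>0 < s\<close> \<open>torus_line \<alpha> s p \<in> barrier x J\<close>
        \<open>\<And>r. 0 < r \<Longrightarrow> r < s \<Longrightarrow> torus_line \<alpha> r p \<notin> barrier x J\<close>
      by (metis linorder_neqE_linordered_idom)
    then show ?thesis using hit "hit.IH" by blast
  qed
qed

lemma speed_pos: "0 < sqrt (1 + (\<alpha>::real)\<^sup>2)"
  by (simp add: add_pos_nonneg)

lemma finite_hits: "finite {s. 0 < s \<and> s \<le> t \<and> torus_line \<alpha> s p \<in> barrier x J}"
proof -
  define c where "c = sqrt (1 + \<alpha>\<^sup>2)"
  have c: "0 < c" unfolding c_def by (rule speed_pos)
  have "{s. 0 < s \<and> s \<le> t \<and> torus_line \<alpha> s p \<in> barrier x J}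
      \<subseteq> (\<lambda>n. c * (real_of_int n + x - fst p)) ` {\<lfloor>fst p\<rfloor>..\<lfloor>fst p + t / c\<rfloor>}"
  proof
    fix s assume "s \<in> {s. 0 < s \<and> s \<le> t \<and> torus_line \<alpha> s p \<in> barrier x J}"
    then have s: "0 < s" "s \<le> t" and fr: "frac (fst p + s / c) = x"
      by (auto simp: torus_line_def wrap_def barrier_def c_def)
    define n where "n = \<lfloor>fst p + s / c\<rfloor>"
    have "s / c \<le> t / c" "0 < s / c" using s c by (auto simp: divide_right_mono)
    then have "n \<in> {\<lfloor>fst p\<rfloor>..\<lfloor>fst p + t / c\<rfloor>}"
      unfolding n_def by (auto intro!: floor_mono)
    moreover have "s / c = real_of_int n + x - fst p"
      using fr by (simp add: frac_def n_def)
    then have "s = c * (real_of_int n + x - fst p)"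
      using c by (simp add: field_simps)
    ultimately show "s \<in> (\<lambda>n. c * (real_of_int n + x - fst p)) ` {\<lfloor>fst p\<rfloor>..\<lfloor>fst p + t / c\<rfloor>}"
      by blast
  qed
  then show ?thesis by (rule finite_subset) simp
qed

lemma dissipates_step:
  assumes "0 \<le> t"
    and step: "\<And>s y. \<lbrakk>0 < s; s \<le> t; torus_line \<alpha> s p \<in> barrier x J\<rbrakk>
      \<Longrightarrow> \<exists>q. dissipates \<alpha> x J (t - s) (0, y) q"
  shows "\<exists>q. dissipates \<alpha> x J t p q"
proof -
  define H where "H = {s. 0 < s \<and> s \<le> t \<and> torus_line \<alpha> s p \<in> barrier x J}"
  have fin: "finite H" unfolding H_def by (rule finite_hits)
  show ?thesis
  proof (cases "H = {}")
    case True
    then have "dissipates \<alpha> x J t p (torus_line \<alpha> t p)"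
      using assms(1) by (intro dissipates.free) (auto simp: H_def)
    then show ?thesis by blast
  next
    case False
    define s where "s = Min H"
    have sH: "s \<in> H" using fin False by (simp add: s_def)
    have min: "s \<le> r" if "r \<in> H" for r using fin that by (simp add: s_def)
    have s: "0 < s" "s \<le> t" "torus_line \<alpha> s p \<in> barrier x J"
      using sH by (auto simp: H_def)
    obtain q where q: "dissipates \<alpha> x J (t - s) (0, snd (torus_line \<alpha> s p)) q"
      using step[OF s] by blast
    have "torus_line \<alpha> r p \<notin> barrier x J" if "0 < r" "r < s" for r
      using min[of r] that s by (auto simp: H_def)
    then show ?thesis using dissipates.hit[OF s _ q] by blast
  qed
qed

lemma dissipates_exists_left_edge:
  assumes "0 < x" "0 \<le> t" "t < real n * (x * sqrt (1 + \<alpha>\<^sup>2))"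
  shows "\<exists>q. dissipates \<alpha> x J t (0, y) q"
  using assms
proof (induction n arbitrary: t y)
  case 0
  then show ?case by simp
next
  case (Suc n)
  define c where "c = sqrt (1 + \<alpha>\<^sup>2)"
  have c: "0 < c" unfolding c_def by (rule speed_pos)
  show ?case
  proof (rule dissipates_step[OF \<open>0 \<le> t\<close>])
    fix s z assume s: "0 < s" "s \<le> t" "torus_line \<alpha> s (0, y) \<in> barrier x J"
    then have "x = frac (s / c)"
      by (auto simp: torus_line_def wrap_def barrier_def c_def)
    also have "\<dots> \<le> s / c" using s(1) c by (simp add: frac_def)
    finally have "x * c \<le> s" using c by (simp add: field_simps)
    then have "t - s < real n * (x * c)"
      using Suc.prems(3) by (simp add: c_def algebra_simps)
    then show "\<exists>q. dissipates \<alpha> x J (t - s) (0, z) q"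
      using Suc.IH[of "t - s" z] Suc.prems(1) s(2) by (simp add: c_def)
  qed
qed

lemma dissipates_ex1:
  assumes "0 < x" "0 \<le> t"
  shows "\<exists>!q. dissipates \<alpha> x J t p q"
proof -
  have "\<exists>q. dissipates \<alpha> x J t p q"
  proof (rule dissipates_step[OF \<open>0 \<le> t\<close>])
    fix s y assume s: "0 < s" "s \<le> t"
    have "0 < x * sqrt (1 + \<alpha>\<^sup>2)" using assms(1) speed_pos by simp
    then obtain n where "t - s < real n * (x * sqrt (1 + \<alpha>\<^sup>2))"
      using reals_Archimedean3 by blast
    then show "\<exists>q. dissipates \<alpha> x J (t - s) (0, y) q"
      using dissipates_exists_left_edge assms(1) s(2) by simp
  qed
  then show ?thesis using dissipates_unique by blast
qed

text \<open>The recurrent set is Borel, so its Lebesgue measure is meaningful.\<close>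

lemma recurrent_set_borel: "recurrent_set \<alpha> x J \<in> sets borel"
proof -
  define W where "W = \<Union>{D. torus_open D \<and>
    (\<exists>t\<^sub>0\<ge>0. \<forall>t>t\<^sub>0. D \<inter> dissipative_flow \<alpha> x J t ` D = {})}"
  have "open (wrap -` W)"
    unfolding W_def vimage_Union by (intro open_UN) (auto simp: torus_open_def)
  moreover have "recurrent_set \<alpha> x J = unit_torus - wrap -` W"
  proof -
    have wrap: "wrap p = p" if "p \<in> unit_torus" for p
      using that by (auto simp: unit_torus_def wrap_def frac_eq)
    have "p \<in> W \<longleftrightarrow> wandering \<alpha> x J p" for p
      unfolding wandering_def W_def by blast
    then show ?thesis
      using wrap by (auto simp: recurrent_set_def simp del: split_paired_All)
  qed
  moreover have "unit_torus \<in> sets borel"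
    unfolding unit_torus_def by (intro borel_Times) auto
  ultimately show ?thesis by auto
qed

end

theory Submission
  imports Defs
begin

text \<open>
  A line of slope \<open>\<alpha>\<close> that starts at \<open>(0, y)\<close> has climbed by exactly \<open>1\<close> after the horizontal
  distance \<open>1 / \<alpha>\<close>, so on the torus it then passes through \<open>(x, y)\<close> with \<open>x = frac (1 / \<alpha>)\<close>.
  For a barrier \<open>{x} \<times> J\<close> at this abscissa, every flow line that leaves \<open>{0} \<times> J\<close> is therefore
  sent back to \<open>{0} \<times> J\<close> within horizontal distance \<open>1 / \<alpha>\<close>, and the band swept out by these
  lines absorbs every flow line that hits the barrier. By Dirichlet's theorem all flow lines do
  so within a common time. Hence the recurrent set lies in the band, whose area is of the order
  of the length of \<open>J\<close>.
\<close>

section \<open>The covering projection of the torus\<close>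

lemma frac_add_of_int: "frac (w + of_int n) = frac w"
  by (simp add: frac_def)

lemma wrap_add_int: "wrap (p + (real_of_int m, real_of_int n)) = wrap p"
  by (simp add: wrap_def frac_add_of_int)

lemma wrap_eq_iff:
  "wrap p = wrap q \<longleftrightarrow> (\<exists>m n. p = q + (real_of_int m, real_of_int n))"
proof
  assume "wrap p = wrap q"
  then have "p = q + (real_of_int (\<lfloor>fst p\<rfloor> - \<lfloor>fst q\<rfloor>), real_of_int (\<lfloor>snd p\<rfloor> - \<lfloor>snd q\<rfloor>))"
    by (auto simp: wrap_def frac_def prod_eq_iff)
  then show "\<exists>m n. p = q + (real_of_int m, real_of_int n)" by blast
qed (auto simp: wrap_add_int)

lemma wrap_in_unit_torus: "wrap p \<in> unit_torus"
  by (simp add: wrap_def unit_torus_def frac_lt_1)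

lemma closed_vimage_wrap_image:
  assumes "compact P"
  shows "closed (wrap -` wrap ` P)"
proof -
  have "wrap -` wrap ` P = (\<Union>p\<in>P. \<Union>q\<in>\<int> \<times> \<int>. {p + q})"
  proof (intro set_eqI)
    fix a
    have "a \<in> wrap -` wrap ` P
        \<longleftrightarrow> (\<exists>p\<in>P. \<exists>m n. a = p + (real_of_int m, real_of_int n))"
      by (simp only: vimage_eq image_iff wrap_eq_iff)
    also have "\<dots> \<longleftrightarrow> (\<exists>p\<in>P. \<exists>q\<in>\<int> \<times> \<int>. a = p + q)"
      by (intro bex_cong refl) (metis Ints_cases Ints_of_int SigmaE SigmaI)
    finally show "a \<in> wrap -` wrap ` P \<longleftrightarrow> a \<in> (\<Union>p\<in>P. \<Union>q\<in>\<int> \<times> \<int>. {p + q})"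
      by (simp only: UN_iff singleton_iff)
  qed
  then show ?thesis
    using compact_closed_sums[OF assms closed_Times[OF closed_Ints closed_Ints]] by simp
qed

section \<open>The absorbing band\<close>

text \<open>The band is kept unwrapped in the plane, with horizontal distance in place of time as
  parameter. The end \<open>1 / \<alpha>\<close>, where a flow line has already jumped back, is
  included so that a compact \<open>J\<close> gives a compact band.\<close>

definition band :: "real \<Rightarrow> real set \<Rightarrow> (real \<times> real) set" where
  "band \<alpha> J = (\<lambda>(s, y). (s, y + \<alpha> * s)) ` ({0..1 / \<alpha>} \<times> J)"

lemma compact_band:
  assumes "compact J"
  shows "compact (band \<alpha> J)"
  unfolding band_def case_prod_unfold
  by (intro compact_continuous_image compact_Times assms compact_Icc continuous_intros)

lemma torus_line_return:
  assumes "\<alpha> > 0" "y \<in> {0..<1}"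
  shows "torus_line \<alpha> (sqrt (1 + \<alpha>\<^sup>2) / \<alpha>) (0, y) = (frac (1 / \<alpha>), y)"
proof -
  have "sqrt (1 + \<alpha>\<^sup>2) / \<alpha> / sqrt (1 + \<alpha>\<^sup>2) = 1 / \<alpha>"
    using speed_pos[of \<alpha>] by simp
  then have "torus_line \<alpha> (sqrt (1 + \<alpha>\<^sup>2) / \<alpha>) (0, y) = wrap (1 / \<alpha>, y + 1)"
    unfolding torus_line_def using assms by simp
  also have "\<dots> = (frac (1 / \<alpha>), y)"
    using assms by (simp add: wrap_def frac_1_eq frac_eq)
  finally show ?thesis .
qed

text \<open>Induction over the hits. A line without a hit has not reached the time of
  \<open>torus_line_return\<close>, at which it would be on the barrier, so it is still in the band.
  A hit, possibly an earlier one, restarts the line on the left edge at a height in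
  \<open>J\<close>, where the induction hypothesis applies.\<close>

lemma dissipates_from_left_edge:
  assumes "\<alpha> > 0" "J \<subseteq> {0..<1}"
    and "dissipates \<alpha> (frac (1 / \<alpha>)) J t p q" "fst p = 0" "snd p \<in> J"
  shows "q \<in> wrap ` band \<alpha> J"
  using assms(3-5)
proof (induction rule: dissipates.induct)
  case (free t p)
  define c where "c = sqrt (1 + \<alpha>\<^sup>2)"
  have c: "0 < c" unfolding c_def by (rule speed_pos)
  have p: "p = (0, snd p)" using free.prems by (simp add: prod_eq_iff)
  have "torus_line \<alpha> (c / \<alpha>) p \<in> barrier (frac (1 / \<alpha>)) J"
    using torus_line_return[of \<alpha> "snd p"] free.prems assms(1,2) p
    by (auto simp: barrier_def c_def)
  then have "\<not> c / \<alpha> \<le> t" using free.hyps(2)[of "c / \<alpha>"] c assms(1) by auto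
  then have "t / c \<in> {0..1 / \<alpha>}"
    using c assms(1) free.hyps(1) by (auto simp: field_simps)
  then have "(t / c, snd p + \<alpha> * (t / c)) \<in> band \<alpha> J"
    unfolding band_def using free.prems by (intro image_eqI[of _ _ "(t / c, snd p)"]) auto
  moreover have "torus_line \<alpha> t p = wrap (t / c, snd p + \<alpha> * (t / c))"
    by (subst p) (simp add: torus_line_def c_def mult.commute)
  ultimately show ?case by simp
next
  case (hit s t p q)
  then show ?case by (auto simp: barrier_def)
qed

text \<open>The given hit excludes the rule \<open>free\<close>. The first hit, at a time
  \<open>r\<close> that may differ from \<open>s\<close>, restarts the line on the left edge over
  \<open>J\<close>, and the previous lemma takes over.\<close>

lemma dissipates_after_hit:
  assumes "\<alpha> > 0" "J \<subseteq> {0..<1}"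
    and "dissipates \<alpha> (frac (1 / \<alpha>)) J t p q"
    and "0 < s" "s \<le> t" "torus_line \<alpha> s p \<in> barrier (frac (1 / \<alpha>)) J"
  shows "q \<in> wrap ` band \<alpha> J"
  using assms(3)
proof (cases rule: dissipates.cases)
  case free
  then show ?thesis using assms by blast
next
  case (hit r)
  then show ?thesis
    using dissipates_from_left_edge[OF assms(1,2) hit(5)] by (auto simp: barrier_def)
qed

section \<open>A common bound for the first hitting time\<close>

text \<open>Modulo 1, some \<open>k\<close> rotations amount to a nonzero shift \<open>d\<close>
  with \<open>\<bar>d\<bar> \<le> \<epsilon>\<close>. Such shifts cannot jump over an interval of
  length \<open>\<epsilon>\<close>, and the number needed to go round the circle is bounded
  independently of \<open>w\<close>.\<close>

lemma irrational_rotation_uniform_entry: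
  fixes \<alpha> \<epsilon> :: real
  assumes "\<alpha> \<notin> \<rat>" "0 < \<epsilon>" "\<epsilon> < 1"
  obtains N :: nat where "\<And>w. \<exists>j. 0 < j \<and> j \<le> N \<and> frac (w + real j * \<alpha>) \<in> {0..\<epsilon>}"
proof -
  obtain M :: nat where M: "M > 0" "1 / M < \<epsilon>"
    by (metis assms(2) gr_zeroI inverse_eq_divide real_arch_inverse)
  obtain h k where k: "0 < k" and hk: "\<bar>of_int k * \<alpha> - of_int h\<bar> < 1 / M"
    using Dirichlet_approx[OF M(1)] by metis
  define d where "d = of_int k * \<alpha> - of_int h"
  have "d \<noteq> 0"
  proof
    assume "d = 0"
    then have "\<alpha> = of_int h / of_int k" using k by (simp add: d_def field_simps)
    then show False using assms(1) by auto
  qed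
  then have d: "0 < \<bar>d\<bar>" "\<bar>d\<bar> \<le> \<epsilon>" "\<bar>d\<bar> < 1"
    using hk M(2) assms(3) by (auto simp: d_def)
  define L where "L = nat \<lceil>2 / \<bar>d\<bar>\<rceil>"
  show thesis
  proof
    fix w :: real
    have "\<exists>i::int. 0 < i \<and> i \<le> \<lceil>2 / \<bar>d\<bar>\<rceil> \<and> (\<exists>n::int. w + i * d - n \<in> {0..\<bar>d\<bar>})"
    proof (cases "0 < d")
      case True
      \<comment> \<open>The target is the first integer strictly above \<open>w\<close>, so at least
        one shift is needed. Rounding up selects the first landing at or beyond it, which overshoots
        by less than \<open>d\<close>.\<close>
      define n where "n = \<lfloor>w\<rfloor> + 1"
      define i where "i = \<lceil>(n - w) / d\<rceil>"
      have n: "0 < n - w" "n - w \<le> 1" unfolding n_def by linarith+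
      have "(n - w) / d \<le> i" "i < (n - w) / d + 1" unfolding i_def by linarith+
      then have "w + i * d - n \<in> {0..\<bar>d\<bar>}" using True by (simp add: field_simps)
      moreover have "0 < i" using n True by (simp add: i_def)
      moreover have "i \<le> \<lceil>2 / \<bar>d\<bar>\<rceil>"
        unfolding i_def using n True by (intro ceiling_mono) (simp add: divide_right_mono)
      ultimately show ?thesis by blast
    next
      case False
      then have "d < 0" using d by simp
      \<comment> \<open>Moving down, the last landing at or above \<open>n\<close> is wanted, hence
        the rounding down. Subtracting 1 keeps the distance to \<open>n\<close> at least 1, which
        exceeds \<open>\<bar>d\<bar>\<close> and forces \<open>0 < i\<close>; the distance may
        approach 2, hence the numerator in \<open>L\<close>.\<close>
      define n where "n = \<lfloor>w\<rfloor> - 1"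
      define i where "i = \<lfloor>(w - n) / \<bar>d\<bar>\<rfloor>"
      have n: "1 \<le> w - n" "w - n \<le> 2" unfolding n_def by linarith+
      have "i \<le> (w - n) / \<bar>d\<bar>" "(w - n) / \<bar>d\<bar> < i + 1" unfolding i_def by linarith+
      then have "w + i * d - n \<in> {0..\<bar>d\<bar>}" using \<open>d < 0\<close> by (simp add: field_simps)
      moreover have "1 \<le> (w - n) / \<bar>d\<bar>" using n d by (simp add: field_simps)
      then have "0 < i" by (simp add: i_def)
      moreover have "(w - n) / \<bar>d\<bar> \<le> 2 / \<bar>d\<bar>" using n d by (simp add: divide_right_mono)
      then have "i \<le> \<lceil>2 / \<bar>d\<bar>\<rceil>" unfolding i_def by linarith
      ultimately show ?thesis by blast
    qed
    then obtain i n :: int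
      where i: "0 < i" "i \<le> \<lceil>2 / \<bar>d\<bar>\<rceil>" and n: "w + i * d - n \<in> {0..\<bar>d\<bar>}" by blast
    define j where "j = nat (i * k)"
    have j: "real j = i * k" using i k by (simp add: j_def)
    have "frac (w + real j * \<alpha>) = frac (w + i * d - n)"
    proof -
      have "w + real j * \<alpha> = (w + i * d - n) + of_int (i * h + n)"
        by (simp add: j d_def algebra_simps)
      then show ?thesis by (simp only: frac_add_of_int)
    qed
    also have "\<dots> = w + i * d - n" using n d by (intro frac_eq[THEN iffD2]) auto
    finally have "frac (w + real j * \<alpha>) \<in> {0..\<epsilon>}" using n d by auto
    moreover have "0 < j" using i k by (simp add: j_def)
    moreover have "j \<le> L * nat k"
      using i k unfolding j_def L_def by (simp add: nat_mult_distrib)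
    ultimately show "\<exists>j. 0 < j \<and> j \<le> L * nat k \<and> frac (w + real j * \<alpha>) \<in> {0..\<epsilon>}" by blast
  qed
qed

text \<open>Successive crossings of the vertical circle at abscissa \<open>x\<close> are one unit of
  horizontal distance apart, and their heights form an orbit of the rotation by
  \<open>\<alpha>\<close>.\<close>

lemma torus_line_uniform_hit:
  fixes \<alpha> \<epsilon> x :: real
  assumes "\<alpha> \<notin> \<rat>" "0 < \<epsilon>" "\<epsilon> < 1" "0 \<le> x" "x < 1"
  obtains t\<^sub>0 where "0 \<le> t\<^sub>0"
    "\<And>p. \<exists>s. 0 < s \<and> s \<le> t\<^sub>0 \<and> torus_line \<alpha> s p \<in> barrier x {0..\<epsilon>}"
proof -
  obtain N :: nat where N: "\<And>w. \<exists>j. 0 < j \<and> j \<le> N \<and> frac (w + real j * \<alpha>) \<in> {0..\<epsilon>}"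
    using irrational_rotation_uniform_entry assms(1-3) by blast
  define c where "c = sqrt (1 + \<alpha>\<^sup>2)"
  have c: "0 < c" unfolding c_def by (rule speed_pos)
  show thesis
  proof
    show "0 \<le> c * (N + 1)" using c by simp
    fix p :: "real \<times> real"
    \<comment> \<open>\<open>h\<close> is the horizontal distance to the first crossing. It can be
      0, and \<open>0 < j\<close> then ensures a positive hitting time.\<close>
    define h where "h = frac (x - fst p)"
    have h: "0 \<le> h" "h < 1" by (simp_all add: h_def frac_lt_1)
    obtain j where j: "0 < j" "j \<le> N" "frac (snd p + h * \<alpha> + real j * \<alpha>) \<in> {0..\<epsilon>}"
      using N by blast
    define s where "s = c * (h + j)"
    have "fst p + (h + j) = x + of_int (int j - \<lfloor>x - fst p\<rfloor>)"
      by (simp add: h_def frac_def)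
    then have "frac (fst p + (h + j)) = frac x"
      by (simp only: frac_add_of_int)
    also have "\<dots> = x" using assms(4,5) by (simp add: frac_eq)
    finally have "frac (fst p + (h + j)) = x" .
    moreover have "s / c = h + j" using c by (simp add: s_def)
    ultimately have "torus_line \<alpha> s p \<in> barrier x {0..\<epsilon>}"
      using j(3) by (simp add: torus_line_def wrap_def barrier_def flip: c_def)
        (simp add: algebra_simps)
    moreover have "0 < s" "s \<le> c * (N + 1)" using c h j(1,2) by (auto simp: s_def)
    ultimately show "\<exists>s. 0 < s \<and> s \<le> c * (N + 1) \<and> torus_line \<alpha> s p \<in> barrier x {0..\<epsilon>}"
      by blast
  qed
qed

text \<open>After the common time \<open>t\<^sub>0\<close> every flow line is in the wrapped band
  for good. The complement of the band is open, so this one set serves as the wandering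
  neighbourhood of each of its points.\<close>

lemma recurrent_set_subset_band:
  fixes \<alpha> \<epsilon> :: real
  assumes "\<alpha> > 0" "\<alpha> \<notin> \<rat>" "0 < \<epsilon>" "\<epsilon> < 1" "0 < frac (1 / \<alpha>)"
  shows "recurrent_set \<alpha> (frac (1 / \<alpha>)) {0..\<epsilon>} \<subseteq> wrap ` band \<alpha> {0..\<epsilon>}"
proof
  fix p assume p: "p \<in> recurrent_set \<alpha> (frac (1 / \<alpha>)) {0..\<epsilon>}"
  obtain t\<^sub>0 where t0: "0 \<le> t\<^sub>0"
    "\<And>p. \<exists>s. 0 < s \<and> s \<le> t\<^sub>0 \<and> torus_line \<alpha> s p \<in> barrier (frac (1 / \<alpha>)) {0..\<epsilon>}"
    using torus_line_uniform_hit[OF assms(2-4) frac_ge_0 frac_lt_1] by blast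
  have flow: "dissipative_flow \<alpha> (frac (1 / \<alpha>)) {0..\<epsilon>} t q \<in> wrap ` band \<alpha> {0..\<epsilon>}"
    if t: "t > t\<^sub>0" for t q
  proof -
    have "dissipates \<alpha> (frac (1 / \<alpha>)) {0..\<epsilon>} t q (dissipative_flow \<alpha> (frac (1 / \<alpha>)) {0..\<epsilon>} t q)"
      unfolding dissipative_flow_def
      using theI'[OF dissipates_ex1[OF assms(5), of t]] t0(1) t by simp
    moreover obtain s where
      "0 < s" "s \<le> t\<^sub>0" "torus_line \<alpha> s q \<in> barrier (frac (1 / \<alpha>)) {0..\<epsilon>}"
      using t0(2) by blast
    ultimately show ?thesis
      using assms t by (intro dissipates_after_hit[where t = t and s = s]) auto
  qed
  show "p \<in> wrap ` band \<alpha> {0..\<epsilon>}"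
  proof (rule ccontr)
    assume "p \<notin> wrap ` band \<alpha> {0..\<epsilon>}"
    moreover define D where "D = unit_torus - wrap ` band \<alpha> {0..\<epsilon>}"
    ultimately have "p \<in> D" using p by (simp add: recurrent_set_def)
    moreover have "wrap -` D = - (wrap -` wrap ` band \<alpha> {0..\<epsilon>})"
      unfolding D_def using wrap_in_unit_torus by blast
    then have "open (wrap -` D)"
      by (simp only: open_Compl closed_vimage_wrap_image compact_band compact_Icc)
    then have "torus_open D" unfolding torus_open_def D_def by blast
    moreover have "\<forall>t>t\<^sub>0. D \<inter> dissipative_flow \<alpha> (frac (1 / \<alpha>)) {0..\<epsilon>} t ` D = {}"
      using flow unfolding D_def by blast
    ultimately have "wandering \<alpha> (frac (1 / \<alpha>)) {0..\<epsilon>} p"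
      using t0(1) unfolding wandering_def by blast
    then show False using p by (simp add: recurrent_set_def)
  qed
qed

section \<open>The area of the band\<close>

text \<open>These boxes contain the pieces into which the integer grid lines cut the band,
  translated to the unit square. The edge \<open>u = 1\<close> is included to make them closed,
  hence Borel.\<close>

definition sheared_box :: "real \<Rightarrow> real \<Rightarrow> real \<Rightarrow> (real \<times> real) set" where
  "sheared_box \<alpha> b \<epsilon> = {(u, v). 0 \<le> u \<and> u \<le> 1 \<and> b + \<alpha> * u \<le> v \<and> v \<le> b + \<alpha> * u + \<epsilon>}"

lemma closed_sheared_box: "closed (sheared_box \<alpha> b \<epsilon>)"
  unfolding sheared_box_def case_prod_unfold
  by (intro closed_Collect_conj closed_Collect_le continuous_intros)

text \<open>Cavalieri's principle: shearing leaves the lengths of the vertical slices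
  unchanged.\<close>

lemma emeasure_sheared_box:
  assumes "0 \<le> \<epsilon>"
  shows "emeasure lborel (sheared_box \<alpha> b \<epsilon>) = ennreal \<epsilon>"
proof -
  have slice: "Pair u -` sheared_box \<alpha> b \<epsilon> = (if u \<in> {0..1} then {b + \<alpha> * u..b + \<alpha> * u + \<epsilon>} else {})"
    for u by (auto simp: sheared_box_def)
  have "emeasure lborel (sheared_box \<alpha> b \<epsilon>)
      = emeasure (lborel \<Otimes>\<^sub>M lborel) (sheared_box \<alpha> b \<epsilon>)"
    by (simp add: lborel_prod)
  also have "\<dots> = (\<integral>\<^sup>+ u. emeasure lborel (Pair u -` sheared_box \<alpha> b \<epsilon>) \<partial>lborel)"
    by (intro lborel.emeasure_pair_measure_alt)
      (simp only: lborel_prod sets_lborel borel_closed[OF closed_sheared_box])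
  also have "\<dots> = (\<integral>\<^sup>+ u. ennreal \<epsilon> * indicator {0..1::real} u \<partial>lborel)"
    using assms by (intro nn_integral_cong) (auto simp: slice)
  also have "\<dots> = ennreal \<epsilon>" by (simp add: nn_integral_cmult)
  finally show ?thesis .
qed

text \<open>Wrapping subtracts \<open>m = \<lfloor>s\<rfloor>\<close> and
  \<open>n = \<lfloor>y + \<alpha> * s\<rfloor>\<close>, which turns the lower edge of the band into
  a line with intercept \<open>\<alpha> * m - n\<close>. Since \<open>\<alpha> * s \<le> 1\<close>
  and \<open>y < 1\<close>, only \<open>n = 0\<close> and \<open>n = 1\<close> occur.\<close>

lemma wrap_band_subset:
  assumes "\<alpha> > 0" "\<epsilon> < 1"
  shows "wrap ` band \<alpha> {0..\<epsilon>}
    \<subseteq> (\<Union>(m, n) \<in> {0..\<lfloor>1 / \<alpha>\<rfloor>} \<times> {0..1}. sheared_box \<alpha> (\<alpha> * of_int m - of_int n) \<epsilon>)"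
proof
  fix q assume "q \<in> wrap ` band \<alpha> {0..\<epsilon>}"
  then obtain s y where s: "0 \<le> s" "s \<le> 1 / \<alpha>" and y: "0 \<le> y" "y \<le> \<epsilon>"
    and q: "q = (frac s, frac (y + \<alpha> * s))"
    by (auto simp: band_def wrap_def)
  have "0 \<le> \<alpha> * s" "\<alpha> * s \<le> 1" using s assms(1) by (auto simp: field_simps)
  then have "0 \<le> \<lfloor>y + \<alpha> * s\<rfloor>" "\<lfloor>y + \<alpha> * s\<rfloor> \<le> 1" using y assms(2) by linarith+
  moreover have "0 \<le> \<lfloor>s\<rfloor>" "\<lfloor>s\<rfloor> \<le> \<lfloor>1 / \<alpha>\<rfloor>" using s by (auto intro: floor_mono)
  moreover have "q \<in> sheared_box \<alpha> (\<alpha> * of_int \<lfloor>s\<rfloor> - of_int \<lfloor>y + \<alpha> * s\<rfloor>) \<epsilon>"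
    using y frac_lt_1[of s] by (simp add: q sheared_box_def less_imp_le) (simp add: frac_def algebra_simps)
  ultimately show "q \<in> (\<Union>(m, n) \<in> {0..\<lfloor>1 / \<alpha>\<rfloor>} \<times> {0..1}.
      sheared_box \<alpha> (\<alpha> * of_int m - of_int n) \<epsilon>)"
    by (intro UN_I[of "(\<lfloor>s\<rfloor>, \<lfloor>y + \<alpha> * s\<rfloor>)"]) auto
qed

text \<open>The number of boxes depends on \<open>\<alpha>\<close> alone, so the bound is linear in
  \<open>\<epsilon>\<close>.\<close>

lemma measure_recurrent_set_le:
  fixes \<alpha> \<epsilon> :: real
  assumes "\<alpha> > 0" "\<alpha> \<notin> \<rat>" "0 < \<epsilon>" "\<epsilon> < 1" "0 < frac (1 / \<alpha>)"
  shows "measure lebesgue (recurrent_set \<alpha> (frac (1 / \<alpha>)) {0..\<epsilon>})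
    \<le> real (card ({0..\<lfloor>1 / \<alpha>\<rfloor>} \<times> {0..1::int})) * \<epsilon>" (is "measure _ ?R \<le> real (card ?I) * _")
proof -
  let ?B = "\<lambda>i. sheared_box \<alpha> (\<alpha> * of_int (fst i) - of_int (snd i)) \<epsilon>"
  have B: "?B i \<in> sets borel" for i by (simp add: closed_sheared_box)
  have "?R \<subseteq> (\<Union>i\<in>?I. ?B i)"
    using recurrent_set_subset_band[OF assms] wrap_band_subset[OF assms(1,4)]
    by (auto simp: case_prod_unfold)
  then have "emeasure lborel ?R \<le> emeasure lborel (\<Union>i\<in>?I. ?B i)"
    using B by (intro emeasure_mono) auto
  also have "\<dots> \<le> (\<Sum>i\<in>?I. emeasure lborel (?B i))"
    using B by (intro emeasure_subadditive_finite) auto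
  also have "\<dots> = ennreal (real (card ?I) * \<epsilon>)"
    using assms(3) by (simp add: emeasure_sheared_box ennreal_mult ennreal_of_nat_eq_real_of_nat)
  finally have "measure lborel ?R \<le> real (card ?I) * \<epsilon>"
    using assms(3) by (auto simp: measure_def intro!: enn2real_leI)
  then show ?thesis
    using recurrent_set_borel by (simp add: measure_completion)
qed

theorem theorem3:
  fixes \<alpha> :: real
  assumes "\<alpha> > 0" and "\<alpha> \<notin> \<rat>" and "\<not> bdd_above (range (cfrac_digit \<alpha>))"
  shows "\<exists>(x :: nat \<Rightarrow> real) (J :: nat \<Rightarrow> real set).
    (\<forall>\<sigma>. 0 < x \<sigma> \<and> x \<sigma> < 1 \<and> is_interval (J \<sigma>) \<and> J \<sigma> \<subset> {0..<1} \<and> 0 < measure lebesgue (J \<sigma>)) \<and>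
    (\<lambda>\<sigma>. measure lebesgue (recurrent_set \<alpha> (x \<sigma>) (J \<sigma>))) \<longlonglongrightarrow> 0"
proof -
  \<comment> \<open>The summand 2 keeps the length below 1 already at
    \<open>\<sigma> = 0\<close>.\<close>
  define \<epsilon> :: "nat \<Rightarrow> real" where "\<epsilon> \<sigma> = 1 / (real \<sigma> + 2)" for \<sigma>
  have \<epsilon>: "0 < \<epsilon> \<sigma>" "\<epsilon> \<sigma> < 1" for \<sigma> by (auto simp: \<epsilon>_def field_simps)
  have "1 / \<alpha> \<notin> \<int>"
  proof
    assume "1 / \<alpha> \<in> \<int>"
    then have "1 / (1 / \<alpha>) \<in> \<rat>" by (intro Rats_divide Rats_1 Ints_subset_Rats[THEN subsetD])
    then show False using assms(2) by simp
  qed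
  then have x: "0 < frac (1 / \<alpha>)" "frac (1 / \<alpha>) < 1"
    by (simp_all add: frac_gt_0_iff frac_lt_1)
  have proper: "{0..\<epsilon> \<sigma>} \<subset> {0..<1}" for \<sigma>
  proof -
    \<comment> \<open>The midpoint of the gap between \<open>\<epsilon> \<sigma>\<close> and 1 shows
      that the inclusion is strict.\<close>
    have "(1 + \<epsilon> \<sigma>) / 2 \<in> {0..<1} - {0..\<epsilon> \<sigma>}" using \<epsilon>[of \<sigma>] by (simp add: field_simps)
    then show ?thesis using \<epsilon>[of \<sigma>] by (intro psubsetI) (force, blast)
  qed
  let ?C = "real (card ({0..\<lfloor>1 / \<alpha>\<rfloor>} \<times> {0..1::int}))"
  have "\<epsilon> \<longlonglongrightarrow> 0"
    unfolding \<epsilon>_def using LIMSEQ_ignore_initial_segment[OF lim_1_over_n, of 2]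
    by (simp add: of_nat_add add.commute)
  then have "(\<lambda>\<sigma>. ?C * \<epsilon> \<sigma>) \<longlonglongrightarrow> 0" by (intro tendsto_mult_right_zero)
  then have "(\<lambda>\<sigma>. measure lebesgue (recurrent_set \<alpha> (frac (1 / \<alpha>)) {0..\<epsilon> \<sigma>})) \<longlonglongrightarrow> 0"
    by (rule tendsto_sandwich[OF always_eventually always_eventually tendsto_const, rotated 2])
      (use measure_recurrent_set_le[OF assms(1,2) \<epsilon> x(1)] in auto)
  then show ?thesis
    \<comment> \<open>All barriers share the abscissa \<open>frac (1 / \<alpha>)\<close>; only their
      lengths shrink.\<close>
    using x proper \<epsilon> by (intro exI[of _ "\<lambda>_. frac (1 / \<alpha>)"] exI[of _ "\<lambda>\<sigma>. {0..\<epsilon> \<sigma>}"])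
      (auto simp: is_interval_cc less_imp_le)
qed

end
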